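(* Let $(p_{M_-,M_+})$ be a family of functions $p_{M_-,M_+}:\mathbb{R}\to\mathbb{R}$ indexed by all pairs $M_-,M_+\in\mathbb{Z}$ with $M_-+M_+\geq 1$. Assume that for all $M_-,M_+\in\mathbb{Z}$ with $M_-+M_+\geq 2$ there are a finite (possibly empty) set $\mathcal{S}_{\sigma_{M_-,M_+,1}}\subset\mathbb{R}$ and functions $\sigma_{M_-,M_+,1,k_{\mathrm{s}}}:\mathbb{R}\setminus\mathcal{S}_{\sigma_{M_-,M_+,1}}\to\mathbb{R}$, $k_{\mathrm{s}}\in\{0,1\}$, such that for all $x\in\mathbb{R}\setminus\mathcal{S}_{\sigma_{M_-,M_+,1}}$ $$\sigma_{M_-,M_+,1,0}(x)+\sigma_{M_-,M_+,1,1}(x)=1,$$ $$p_{M_-,M_+}(x)=\sigma_{M_-,M_+,1,0}(x)\,p_{M_-,M_+-1}(x)+\sigma_{M_-,M_+,1,1}(x)\,p_{M_--1,M_+}(x).$$ For all $M_-,M_+\in\mathbb{Z}$ with $M:=M_-+M_+\geq 2$, all integers $K_{\mathrm{s}}$ with $2\leq K_{\mathrm{s}}\leq M-1$, and all $k_{\mathrm{s}}\in\{0,\dots,K_{\mathrm{s}}\}$, define recursively $$\sigma_{M_-,M_+,K_{\mathrm{s}},k_{\mathrm{s}}}(x):=\sum_{\ell_{\mathrm{s}}=\max(0,k_{\mathrm{s}}-1)}^{\min(K_{\mathrm{s}}-1,k_{\mathrm{s}})}\sigma_{M_-,M_+,K_{\mathrm{s}}-1,\ell_{\mathrm{s}}}(x)\;\sigma_{M_--\ell_{\mathrm{s}},\,M_+-(K_{\mathrm{s}}-1)+\ell_{\mathrm{s}},\,1,\,k_{\mathrm{s}}-\ell_{\mathrm{s}}}(x).$$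 Then for all $M_-,M_+\in\mathbb{Z}$ with $M:=M_-+M_+\geq 2$, all integers $K_{\mathrm{s}}$ with $1\leq K_{\mathrm{s}}\leq M-1$, and all $$x\in\mathbb{R}\setminus\bigcup_{L_{\mathrm{s}}=0}^{K_{\mathrm{s}}-1}\bigcup_{\ell_{\mathrm{s}}=0}^{L_{\mathrm{s}}}\mathcal{S}_{\sigma_{M_--\ell_{\mathrm{s}},\,M_+-L_{\mathrm{s}}+\ell_{\mathrm{s}},\,1}},$$ one has $$p_{M_-,M_+}(x)=\sum_{k_{\mathrm{s}}=0}^{K_{\mathrm{s}}}\sigma_{M_-,M_+,K_{\mathrm{s}},k_{\mathrm{s}}}(x)\;p_{M_--k_{\mathrm{s}},\,M_+-K_{\mathrm{s}}+k_{\mathrm{s}}}(x)$$ and $$\sum_{k_{\mathrm{s}}=0}^{K_{\mathrm{s}}}\sigma_{M_-,M_+,K_{\mathrm{s}},k_{\mathrm{s}}}(x)=1.$$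
   Context: The functions $\sigma_{M_-,M_+,K_{\mathrm{s}},k_{\mathrm{s}}}$ are called weight-functions of level $K_{\mathrm{s}}$; those of level $1$ are given, and those of level $K_{\mathrm{s}}\geq2$ are defined by the recursion, wherever all level-1 functions involved are defined. *)

theory Defs
  imports Complex_Main
begin

text \<open>
  Weight-functions of level \<open>K\<close>, built from given level-1 functions \<open>s M\<^sub>- M\<^sub>+ k\<close>. The lower
  summation bound \<open>max(0, k - 1)\<close> is written as the truncated natural-number difference \<open>k - 1\<close>.
  The partially defined functions of the source are represented by total ones: values at
  points of the exceptional sets, or for indices outside the stated ranges, carry no meaning.
  There is no level 0.
\<close>

fun weight :: "(int \<Rightarrow> int \<Rightarrow> nat \<Rightarrow> real \<Rightarrow> real) \<Rightarrow> int \<Rightarrow> int \<Rightarrow> nat \<Rightarrow> nat \<Rightarrow> real \<Rightarrow> real"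
where
  "weight s Mm Mp 0 k x = undefined"
| "weight s Mm Mp (Suc 0) k x = s Mm Mp k x"
| "weight s Mm Mp (Suc (Suc K)) k x =
     (\<Sum>l = k - 1..min (Suc K) k.
        weight s Mm Mp (Suc K) l x * s (Mm - int l) (Mp - int (Suc K) + int l) (k - l) x)"

end

theory Submission
  imports Defs
begin

text \<open>Induction on \<open>K\<close>. Each \<open>p\<close> in the level-\<open>K\<close>
  identity has index sum \<open>Mm + Mp - K\<close>, so the level-1 recursion splits the
  \<open>l\<close>-th one into two neighbours, at positions \<open>l\<close> and
  \<open>Suc l\<close> of level \<open>Suc K\<close>. Collecting the coefficient of position
  \<open>k\<close> gives the recursive definition of \<open>weight\<close>. The normalisation
  follows by the same regrouping with all values replaced by 1. \<open>sum_weight_Suc\<close>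
  handles both cases through an arbitrary factor \<open>g\<close>.\<close>

text \<open>Both sides sum over the pairs with \<open>k = l\<close> or \<open>k = Suc l\<close>,
  grouped by \<open>k\<close> on the left and by \<open>l\<close> on the right.\<close>

lemma sum_two_band:
  fixes w g :: "nat \<Rightarrow> 'a::comm_ring" and t :: "nat \<Rightarrow> nat \<Rightarrow> 'a"
  shows "(\<Sum>k = 0..Suc n. (\<Sum>l = k - 1..min n k. w l * t l (k - l)) * g k)
    = (\<Sum>l = 0..n. w l * (t l 0 * g l + t l 1 * g (Suc l)))"
proof -
  \<comment> \<open>Boundary rows have one entry: truncation makes \<open>k = 0\<close> give only
    \<open>l = 0\<close>, and \<open>min\<close> makes \<open>k = Suc n\<close> give only
    \<open>l = n\<close>.\<close>
  have rows: "{k - 1..min n k} = {l \<in> {0..n}. k = l \<or> k = Suc l}"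
    if "k \<in> {0..Suc n}" for k
    using that by auto
  have cols: "{k \<in> {0..Suc n}. k = l \<or> k = Suc l} = {l, Suc l}" if "l \<in> {0..n}" for l
    using that by auto
  have "(\<Sum>k = 0..Suc n. (\<Sum>l = k - 1..min n k. w l * t l (k - l)) * g k)
    = (\<Sum>k\<in>{0..Suc n}. \<Sum>l | l \<in> {0..n} \<and> (k = l \<or> k = Suc l). w l * t l (k - l) * g k)"
    by (intro sum.cong refl) (simp only: rows sum_distrib_right)
  also have "\<dots> = (\<Sum>l\<in>{0..n}. \<Sum>k | k \<in> {0..Suc n} \<and> (k = l \<or> k = Suc l). w l * t l (k - l) * g k)"
    by (rule sum.swap_restrict) simp_all
  also have "\<dots> = (\<Sum>l = 0..n. w l * (t l 0 * g l + t l 1 * g (Suc l)))"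
    by (intro sum.cong refl) (simp only: cols, simp add: algebra_simps)
  finally show ?thesis .
qed

lemma sum_weight_Suc:
  assumes "K \<ge> 1"
  shows "(\<Sum>k = 0..Suc K. weight s Mm Mp (Suc K) k x * g k)
    = (\<Sum>l = 0..K. weight s Mm Mp K l x *
        (s (Mm - int l) (Mp - int K + int l) 0 x * g l
         + s (Mm - int l) (Mp - int K + int l) 1 x * g (Suc l)))"
proof -
  \<comment> \<open>The recursive equation of \<open>weight\<close> only fires at
    \<open>Suc (Suc n)\<close>; level 0 is undefined.\<close>
  obtain n where "K = Suc n"
    using assms by (cases K) auto
  then show ?thesis
    using sum_two_band[where n = K and g = g and w = "\<lambda>l. weight s Mm Mp K l x"
        and t = "\<lambda>l j. s (Mm - int l) (Mp - int K + int l) j x"]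
    by simp
qed

theorem lemma2p1:
  fixes p :: "int \<Rightarrow> int \<Rightarrow> real \<Rightarrow> real"
    and S :: "int \<Rightarrow> int \<Rightarrow> real set"
    and \<sigma>1 :: "int \<Rightarrow> int \<Rightarrow> nat \<Rightarrow> real \<Rightarrow> real"
  assumes finite_S: "\<And>Mm Mp. Mm + Mp \<ge> 2 \<Longrightarrow> finite (S Mm Mp)"
    and sum_one: "\<And>Mm Mp x. Mm + Mp \<ge> 2 \<Longrightarrow> x \<notin> S Mm Mp \<Longrightarrow>
        \<sigma>1 Mm Mp 0 x + \<sigma>1 Mm Mp 1 x = 1"
    and recursion: "\<And>Mm Mp x. Mm + Mp \<ge> 2 \<Longrightarrow> x \<notin> S Mm Mp \<Longrightarrow>
        p Mm Mp x = \<sigma>1 Mm Mp 0 x * p Mm (Mp - 1) x + \<sigma>1 Mm Mp 1 x * p (Mm - 1) Mp x"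
  shows "\<forall>Mm Mp. Mm + Mp \<ge> 2 \<longrightarrow>
    (\<forall>K::nat. 1 \<le> K \<and> int K \<le> Mm + Mp - 1 \<longrightarrow>
      (\<forall>x. x \<notin> (\<Union>L\<in>{0..K - 1}. \<Union>l\<in>{0..L}. S (Mm - int l) (Mp - int L + int l)) \<longrightarrow>
        p Mm Mp x = (\<Sum>k = 0..K. weight \<sigma>1 Mm Mp K k x * p (Mm - int k) (Mp - int K + int k) x)
        \<and> (\<Sum>k = 0..K. weight \<sigma>1 Mm Mp K k x) = 1))"
proof (intro allI impI, elim conjE)
  fix Mm Mp :: int and K :: nat and x :: real
  assume K1: "1 \<le> K" and KM: "int K \<le> Mm + Mp - 1"
    and x: "x \<notin> (\<Union>L\<in>{0..K - 1}. \<Union>l\<in>{0..L}. S (Mm - int l) (Mp - int L + int l))"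
  \<comment> \<open>With \<open>L < K\<close> as a premise, the condition for \<open>Suc K\<close>
    visibly implies the one for \<open>K\<close>, as the induction requires.\<close>
  have regular: "x \<notin> S (Mm - int l) (Mp - int L + int l)" if "l \<le> L" "L < K" for l L
    using x that by fastforce
  show "p Mm Mp x = (\<Sum>k = 0..K. weight \<sigma>1 Mm Mp K k x * p (Mm - int k) (Mp - int K + int k) x)
      \<and> (\<Sum>k = 0..K. weight \<sigma>1 Mm Mp K k x) = 1"
    using K1 KM regular
  proof (induction K rule: nat_induct_at_least)
    case base
    have "x \<notin> S Mm Mp"
      using base.prems(2)[of 0 0] by simp
    then show ?case
      using sum_one[of Mm Mp x] recursion[of Mm Mp x] base.prems(1) by simp
  next
    case (Suc K)
    have IH: "p Mm Mp x = (\<Sum>k = 0..K. weight \<sigma>1 Mm Mp K k x * p (Mm - int k) (Mp - int K + int k) x)"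
      "(\<Sum>k = 0..K. weight \<sigma>1 Mm Mp K k x) = 1"
      using Suc.IH Suc.prems by simp_all
    \<comment> \<open>Here \<open>L = K\<close> is the newly excluded layer, and
      \<open>int (Suc K) \<le> Mm + Mp - 1\<close> makes the index sum \<open>Mm + Mp - K\<close> at
      least 2.\<close>
    have one: "\<sigma>1 (Mm - int l) (Mp - int K + int l) 0 x + \<sigma>1 (Mm - int l) (Mp - int K + int l) 1 x = 1"
      if "l \<in> {0..K}" for l
      using that Suc.prems by (intro sum_one) auto
    \<comment> \<open>The indices are written so that the two terms are \<open>g l\<close> and
      \<open>g (Suc l)\<close> for one function \<open>g\<close>, as \<open>sum_weight_Suc\<close>
      expects.\<close>
    have rec: "p (Mm - int l) (Mp - int K + int l) x
        = \<sigma>1 (Mm - int l) (Mp - int K + int l) 0 x * p (Mm - int l) (Mp - int (Suc K) + int l) x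
        + \<sigma>1 (Mm - int l) (Mp - int K + int l) 1 x
          * p (Mm - int (Suc l)) (Mp - int (Suc K) + int (Suc l)) x"
      if "l \<in> {0..K}" for l
      using that Suc.prems recursion[of "Mm - int l" "Mp - int K + int l" x]
      by (simp add: algebra_simps)
    have "p Mm Mp x = (\<Sum>k = 0..Suc K. weight \<sigma>1 Mm Mp (Suc K) k x
        * p (Mm - int k) (Mp - int (Suc K) + int k) x)"
      unfolding sum_weight_Suc[OF Suc.hyps] IH(1)
      by (intro sum.cong refl arg_cong2[where f = "(*)"] rec)
    moreover have "(\<Sum>k = 0..Suc K. weight \<sigma>1 Mm Mp (Suc K) k x) = 1"
      using sum_weight_Suc[OF Suc.hyps, where g = "\<lambda>_. 1" and s = \<sigma>1 and Mm = Mm and Mp = Mp and x = x]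
        one IH(2) by simp
    ultimately show ?case ..
  qed
qed

end
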